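(* Let $S$ be a ring. Then the following hold: (1) For any $m \geq 1$ and any $n \geq 2$, the ring $T_m(S)$ satisfies Property $K_n$ if and only if $S$ satisfies Property $K_n$. (2) For any $m \geq 1$ and any $n \geq 2$, the ring $T_m(S)$ satisfies Property $\overline{K_n}$ if and only if $S$ satisfies Property $\overline{K_n}$.
   Context: Rings are associative with unity, not necessarily commutative. $T_m(S)$ is the ring of $m\times m$ upper triangular matrices over $S$. An element $x$ of a ring is $n$-potent if $x^n = x$. For elements $a,b$ of a ring and an integer $n \geq 2$: $\langle a,b\rangle_n := (a+b)^n - a^n - b^n$, $[a,b]_n^L := (a-b)(a+b)^{n-1} - (a^n - b^n)$, and $[a,b]_n^R := (a+b)^{n-1}(a-b) - (a^n-b^n)$. A ring $R$ satisfies Property $K_n$ if there exist $n$-potent elements $a,b \in R$ such that $[a,b]_n^L$ and $[a,b]_n^R$ are both units in $R$. A ring $R$ satisfies Property $\overline{K_n}$ if there exist $n$-potent elements $a,b \in R$ such that $\langle a,b\rangle_n$ is a unit in $R$. *)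

theory Defs
  imports "HOL-Algebra.Algebra" "Jordan_Normal_Form.Matrix"
begin

definition potent :: "('a, 'b) ring_scheme \<Rightarrow> nat \<Rightarrow> 'a \<Rightarrow> bool" where
  "potent R n x \<longleftrightarrow> x \<in> carrier R \<and> x [^]\<^bsub>R\<^esub> n = x"

definition angle_bracket :: "('a, 'b) ring_scheme \<Rightarrow> nat \<Rightarrow> 'a \<Rightarrow> 'a \<Rightarrow> 'a" where
  "angle_bracket R n a b =
     ((a \<oplus>\<^bsub>R\<^esub> b) [^]\<^bsub>R\<^esub> n \<ominus>\<^bsub>R\<^esub> a [^]\<^bsub>R\<^esub> n) \<ominus>\<^bsub>R\<^esub> b [^]\<^bsub>R\<^esub> n"

text \<open>The exponent \<open>n - 1\<close> is a subtraction of natural numbers;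
  the brackets are only used for \<open>n \<ge> 2\<close>.\<close>

definition bracket_L :: "('a, 'b) ring_scheme \<Rightarrow> nat \<Rightarrow> 'a \<Rightarrow> 'a \<Rightarrow> 'a" where
  "bracket_L R n a b =
     ((a \<ominus>\<^bsub>R\<^esub> b) \<otimes>\<^bsub>R\<^esub> (a \<oplus>\<^bsub>R\<^esub> b) [^]\<^bsub>R\<^esub> (n - 1))
       \<ominus>\<^bsub>R\<^esub> (a [^]\<^bsub>R\<^esub> n \<ominus>\<^bsub>R\<^esub> b [^]\<^bsub>R\<^esub> n)"

definition bracket_R :: "('a, 'b) ring_scheme \<Rightarrow> nat \<Rightarrow> 'a \<Rightarrow> 'a \<Rightarrow> 'a" where
  "bracket_R R n a b =
     ((a \<oplus>\<^bsub>R\<^esub> b) [^]\<^bsub>R\<^esub> (n - 1) \<otimes>\<^bsub>R\<^esub> (a \<ominus>\<^bsub>R\<^esub> b))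
       \<ominus>\<^bsub>R\<^esub> (a [^]\<^bsub>R\<^esub> n \<ominus>\<^bsub>R\<^esub> b [^]\<^bsub>R\<^esub> n)"

definition property_K :: "('a, 'b) ring_scheme \<Rightarrow> nat \<Rightarrow> bool" where
  "property_K R n \<longleftrightarrow>
     (\<exists>a b. potent R n a \<and> potent R n b \<and>
        bracket_L R n a b \<in> Units R \<and> bracket_R R n a b \<in> Units R)"

definition property_Kbar :: "('a, 'b) ring_scheme \<Rightarrow> nat \<Rightarrow> bool" where
  "property_Kbar R n \<longleftrightarrow>
     (\<exists>a b. potent R n a \<and> potent R n b \<and> angle_bracket R n a b \<in> Units R)"

text \<open>The ring \<open>T\<^sub>m(S)\<close>. The type of matrices serves only as a container for the entries
  (row and column indices range over \<open>{0..<m}\<close>): its own class-based arithmetic is not used,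
  all operations are those of the ring \<open>S\<close>.\<close>

definition upper_triangular_ring ::
  "nat \<Rightarrow> ('a, 'b) ring_scheme \<Rightarrow> 'a mat ring" where
  "upper_triangular_ring m S =
    \<lparr> carrier = {A \<in> carrier_mat m m.
        (\<forall>i<m. \<forall>j<m. A $$ (i, j) \<in> carrier S) \<and>
        (\<forall>i<m. \<forall>j<i. A $$ (i, j) = \<zero>\<^bsub>S\<^esub>)},
      monoid.mult = (\<lambda>A B. mat m m (\<lambda>(i, j).
        \<Oplus>\<^bsub>S\<^esub>k\<in>{0..<m}. A $$ (i, k) \<otimes>\<^bsub>S\<^esub> B $$ (k, j))),
      monoid.one = mat m m (\<lambda>(i, j). if i = j then \<one>\<^bsub>S\<^esub> else \<zero>\<^bsub>S\<^esub>),
      ring.zero = mat m m (\<lambda>(i, j). \<zero>\<^bsub>S\<^esub>),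
      ring.add = (\<lambda>A B. mat m m (\<lambda>(i, j). A $$ (i, j) \<oplus>\<^bsub>S\<^esub> B $$ (i, j))) \<rparr>"

end

theory Submission
  imports Defs
begin

text \<open>Both properties assert that two elements exist which satisfy equations and have certain
  polynomial expressions in them invertible, all written with the ring operations alone. A unital
  ring homomorphism \<open>h : R \<rightarrow> R'\<close> commutes with the ring operations and maps units to units, so it
  carries witnesses in \<open>R\<close> to witnesses in \<open>R'\<close>: this is \<open>property_K_hom\<close> and \<open>property_Kbar_hom\<close>.

  The theorem follows because there are homomorphisms between \<open>S\<close> and \<open>T\<^sub>m(S)\<close> in both directions
  for \<open>m \<ge> 1\<close>: the embedding of \<open>S\<close> as scalar matrices, and the projection onto a diagonal entry,
  which is multiplicative since in the sum \<open>\<Sum>\<^sub>k A\<^sub>i\<^sub>k B\<^sub>k\<^sub>i\<close> of upper triangular matrices only the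
  term \<open>k = i\<close> survives. Most of the work is in checking that \<open>T\<^sub>m(S)\<close> is a ring when the entries
  come from an arbitrary, possibly noncommutative, ring.\<close>

section \<open>Transport along ring homomorphisms\<close>

context ring_hom_ring
begin

lemma hom_minus:
  "\<lbrakk>x \<in> carrier R; y \<in> carrier R\<rbrakk> \<Longrightarrow> h (x \<ominus>\<^bsub>R\<^esub> y) = h x \<ominus>\<^bsub>S\<^esub> h y"
  by (simp add: a_minus_def)

lemma hom_Units:
  assumes "x \<in> Units R"
  shows "h x \<in> Units S"
proof -
  from assms obtain y where y: "x \<in> carrier R" "y \<in> carrier R"
      "y \<otimes>\<^bsub>R\<^esub> x = \<one>\<^bsub>R\<^esub>" "x \<otimes>\<^bsub>R\<^esub> y = \<one>\<^bsub>R\<^esub>"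
    by (auto simp: Units_def)
  then have "h y \<otimes>\<^bsub>S\<^esub> h x = \<one>\<^bsub>S\<^esub>" "h x \<otimes>\<^bsub>S\<^esub> h y = \<one>\<^bsub>S\<^esub>"
    by (metis hom_mult hom_one)+
  with y show ?thesis
    by (auto simp: Units_def)
qed

lemma hom_potent: "potent R n x \<Longrightarrow> potent S n (h x)"
  by (metis hom_closed hom_nat_pow potent_def)

lemma hom_brackets:
  assumes "a \<in> carrier R" "b \<in> carrier R"
  shows "h (angle_bracket R n a b) = angle_bracket S n (h a) (h b)"
    and "h (bracket_L R n a b) = bracket_L S n (h a) (h b)"
    and "h (bracket_R R n a b) = bracket_R S n (h a) (h b)"
  using assms
  by (simp_all add: angle_bracket_def bracket_L_def bracket_R_def hom_minus hom_nat_pow)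

lemma property_K_hom: "property_K R n \<Longrightarrow> property_K S n"
  unfolding property_K_def by (metis hom_Units hom_brackets(2,3) hom_potent potent_def)

lemma property_Kbar_hom: "property_Kbar R n \<Longrightarrow> property_Kbar S n"
  unfolding property_Kbar_def by (metis hom_Units hom_brackets(1) hom_potent potent_def)

end

section \<open>The ring of upper triangular matrices\<close>

lemma upper_triangular_ring_sel:
  "A \<in> carrier (upper_triangular_ring m S) \<longleftrightarrow>
     A \<in> carrier_mat m m \<and> (\<forall>i<m. \<forall>j<m. A $$ (i, j) \<in> carrier S) \<and>
     (\<forall>i<m. \<forall>j<i. A $$ (i, j) = \<zero>\<^bsub>S\<^esub>)"
  "A \<otimes>\<^bsub>upper_triangular_ring m S\<^esub> B =
     mat m m (\<lambda>(i, j). \<Oplus>\<^bsub>S\<^esub>k\<in>{0..<m}. A $$ (i, k) \<otimes>\<^bsub>S\<^esub> B $$ (k, j))"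
  "\<one>\<^bsub>upper_triangular_ring m S\<^esub> = mat m m (\<lambda>(i, j). if i = j then \<one>\<^bsub>S\<^esub> else \<zero>\<^bsub>S\<^esub>)"
  "\<zero>\<^bsub>upper_triangular_ring m S\<^esub> = mat m m (\<lambda>(i, j). \<zero>\<^bsub>S\<^esub>)"
  "A \<oplus>\<^bsub>upper_triangular_ring m S\<^esub> B = mat m m (\<lambda>(i, j). A $$ (i, j) \<oplus>\<^bsub>S\<^esub> B $$ (i, j))"
  by (simp_all add: upper_triangular_ring_def)

context ring
begin

text \<open>Every sum that has to be evaluated explicitly here (a product with a scalar matrix, a
  diagonal entry of a product) has at most one nonzero term.\<close>

lemma finsum_single:
  assumes "finite A" "i \<in> A" "f i \<in> carrier R" "\<And>k. \<lbrakk>k \<in> A; k \<noteq> i\<rbrakk> \<Longrightarrow> f k = \<zero>"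
  shows "(\<Oplus>k\<in>A. f k) = f i"
proof -
  have "(\<Oplus>k\<in>A. f k) = (\<Oplus>k\<in>A. if i = k then f i else \<zero>)"
    using assms by (intro finsum_cong') auto
  also have "\<dots> = f i"
    using assms by (intro finsum_singleton) auto
  finally show ?thesis .
qed

lemma upper_triangular_ring_mult_closed:
  assumes A: "A \<in> carrier (upper_triangular_ring m R)"
    and B: "B \<in> carrier (upper_triangular_ring m R)"
  shows "A \<otimes>\<^bsub>upper_triangular_ring m R\<^esub> B \<in> carrier (upper_triangular_ring m R)"
proof -
  have "(\<Oplus>k\<in>{0..<m}. A $$ (i, k) \<otimes> B $$ (k, j)) = \<zero>" if "i < m" "j < i" for i j
  proof (intro add.finprod_one_eqI)
    fix k assume k: "k \<in> {0..<m}"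
    \<comment> \<open>Either \<open>k < i\<close> and the left factor vanishes, or \<open>j < i \<le> k\<close> and the right one does.\<close>
    from that k A B show "A $$ (i, k) \<otimes> B $$ (k, j) = \<zero>"
      by (cases "k < i") (auto simp: upper_triangular_ring_sel)
  qed
  then show ?thesis
    using A B by (auto simp: upper_triangular_ring_sel intro!: finsum_closed)
qed

text \<open>Both sides have the \<open>(i, j)\<close> entry \<open>\<Sum>\<^sub>k\<^sub>,\<^sub>l A\<^sub>i\<^sub>l B\<^sub>l\<^sub>k C\<^sub>k\<^sub>j\<close>, so that associativity is an interchange
  of two finite sums.\<close>

lemma upper_triangular_ring_mult_assoc:
  assumes A: "A \<in> carrier (upper_triangular_ring m R)"
    and B: "B \<in> carrier (upper_triangular_ring m R)"
    and C: "C \<in> carrier (upper_triangular_ring m R)"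
  shows "(A \<otimes>\<^bsub>upper_triangular_ring m R\<^esub> B) \<otimes>\<^bsub>upper_triangular_ring m R\<^esub> C =
    A \<otimes>\<^bsub>upper_triangular_ring m R\<^esub> (B \<otimes>\<^bsub>upper_triangular_ring m R\<^esub> C)"
proof -
  have entry: "M $$ (i, j) \<in> carrier R" if "M \<in> {A, B, C}" "i < m" "j < m" for M i j
    using that A B C by (auto simp: upper_triangular_ring_sel)
  have "(\<Oplus>k\<in>{0..<m}. mat m m (\<lambda>(i, j). \<Oplus>l\<in>{0..<m}. A $$ (i, l) \<otimes> B $$ (l, j)) $$ (i, k)
        \<otimes> C $$ (k, j)) =
      (\<Oplus>l\<in>{0..<m}. A $$ (i, l) \<otimes>
        mat m m (\<lambda>(i, j). \<Oplus>k\<in>{0..<m}. B $$ (i, k) \<otimes> C $$ (k, j)) $$ (l, j))"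
    (is "?l = ?r") if ij: "i < m" "j < m" for i j
  proof -
    have "?l = (\<Oplus>k\<in>{0..<m}. (\<Oplus>l\<in>{0..<m}. A $$ (i, l) \<otimes> B $$ (l, k)) \<otimes> C $$ (k, j))"
      using ij entry by (intro finsum_cong') (auto intro!: finsum_closed)
    also have "\<dots> = (\<Oplus>k\<in>{0..<m}. \<Oplus>l\<in>{0..<m}. A $$ (i, l) \<otimes> B $$ (l, k) \<otimes> C $$ (k, j))"
      using ij entry by (intro finsum_cong' finsum_ldistr) (auto intro!: finsum_closed)
    also have "\<dots> = (\<Oplus>l\<in>{0..<m}. \<Oplus>k\<in>{0..<m}. A $$ (i, l) \<otimes> B $$ (l, k) \<otimes> C $$ (k, j))"
      using ij entry by (intro finsum_finsum_swap) auto
    also have "\<dots> = (\<Oplus>l\<in>{0..<m}. \<Oplus>k\<in>{0..<m}. A $$ (i, l) \<otimes> (B $$ (l, k) \<otimes> C $$ (k, j)))"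
      using ij entry by (intro finsum_cong') (auto simp: m_assoc intro!: finsum_closed)
    also have "\<dots> = (\<Oplus>l\<in>{0..<m}. A $$ (i, l) \<otimes> (\<Oplus>k\<in>{0..<m}. B $$ (l, k) \<otimes> C $$ (k, j)))"
      using ij entry
      by (intro finsum_cong' finsum_rdistr[symmetric]) (auto intro!: finsum_closed)
    also have "\<dots> = ?r"
      using ij entry by (intro finsum_cong') (auto intro!: finsum_closed)
    finally show ?thesis .
  qed
  then show ?thesis
    by (auto simp: upper_triangular_ring_sel intro!: eq_matI)
qed

lemma upper_triangular_ring_one:
  assumes A: "A \<in> carrier (upper_triangular_ring m R)"
  shows "\<one>\<^bsub>upper_triangular_ring m R\<^esub> \<otimes>\<^bsub>upper_triangular_ring m R\<^esub> A = A"
    and "A \<otimes>\<^bsub>upper_triangular_ring m R\<^esub> \<one>\<^bsub>upper_triangular_ring m R\<^esub> = A"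
proof -
  have entry: "A $$ (i, j) \<in> carrier R" if "i < m" "j < m" for i j
    using that A by (auto simp: upper_triangular_ring_sel)
  have "(\<Oplus>k\<in>{0..<m}. mat m m (\<lambda>(i, j). if i = j then \<one> else \<zero>) $$ (i, k) \<otimes> A $$ (k, j)) = A $$ (i, j)"
    and "(\<Oplus>k\<in>{0..<m}. A $$ (i, k) \<otimes> mat m m (\<lambda>(i, j). if i = j then \<one> else \<zero>) $$ (k, j)) = A $$ (i, j)"
    if "i < m" "j < m" for i j
    using that entry by (subst finsum_single[of _ i] finsum_single[of _ j]; auto)+
  then show "\<one>\<^bsub>upper_triangular_ring m R\<^esub> \<otimes>\<^bsub>upper_triangular_ring m R\<^esub> A = A"
    and "A \<otimes>\<^bsub>upper_triangular_ring m R\<^esub> \<one>\<^bsub>upper_triangular_ring m R\<^esub> = A"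
    using A by (auto simp: upper_triangular_ring_sel intro!: eq_matI)
qed

lemma upper_triangular_ring_distrib:
  assumes A: "A \<in> carrier (upper_triangular_ring m R)"
    and B: "B \<in> carrier (upper_triangular_ring m R)"
    and C: "C \<in> carrier (upper_triangular_ring m R)"
  shows "(A \<oplus>\<^bsub>upper_triangular_ring m R\<^esub> B) \<otimes>\<^bsub>upper_triangular_ring m R\<^esub> C =
      A \<otimes>\<^bsub>upper_triangular_ring m R\<^esub> C \<oplus>\<^bsub>upper_triangular_ring m R\<^esub> B \<otimes>\<^bsub>upper_triangular_ring m R\<^esub> C"
    and "C \<otimes>\<^bsub>upper_triangular_ring m R\<^esub> (A \<oplus>\<^bsub>upper_triangular_ring m R\<^esub> B) =
      C \<otimes>\<^bsub>upper_triangular_ring m R\<^esub> A \<oplus>\<^bsub>upper_triangular_ring m R\<^esub> C \<otimes>\<^bsub>upper_triangular_ring m R\<^esub> B"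
proof -
  have entry: "M $$ (i, j) \<in> carrier R" if "M \<in> {A, B, C}" "i < m" "j < m" for M i j
    using that A B C by (auto simp: upper_triangular_ring_sel)
  have "(\<Oplus>k\<in>{0..<m}. mat m m (\<lambda>(i, j). A $$ (i, j) \<oplus> B $$ (i, j)) $$ (i, k) \<otimes> C $$ (k, j)) =
      (\<Oplus>k\<in>{0..<m}. A $$ (i, k) \<otimes> C $$ (k, j)) \<oplus> (\<Oplus>k\<in>{0..<m}. B $$ (i, k) \<otimes> C $$ (k, j))"
    and "(\<Oplus>k\<in>{0..<m}. C $$ (i, k) \<otimes> mat m m (\<lambda>(i, j). A $$ (i, j) \<oplus> B $$ (i, j)) $$ (k, j)) =
      (\<Oplus>k\<in>{0..<m}. C $$ (i, k) \<otimes> A $$ (k, j)) \<oplus> (\<Oplus>k\<in>{0..<m}. C $$ (i, k) \<otimes> B $$ (k, j))"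
    if ij: "i < m" "j < m" for i j
    using ij entry
    by (subst finsum_addf[symmetric]; (intro finsum_cong')?; auto simp: l_distr r_distr)+
  then show "(A \<oplus>\<^bsub>upper_triangular_ring m R\<^esub> B) \<otimes>\<^bsub>upper_triangular_ring m R\<^esub> C =
      A \<otimes>\<^bsub>upper_triangular_ring m R\<^esub> C \<oplus>\<^bsub>upper_triangular_ring m R\<^esub> B \<otimes>\<^bsub>upper_triangular_ring m R\<^esub> C"
    and "C \<otimes>\<^bsub>upper_triangular_ring m R\<^esub> (A \<oplus>\<^bsub>upper_triangular_ring m R\<^esub> B) =
      C \<otimes>\<^bsub>upper_triangular_ring m R\<^esub> A \<oplus>\<^bsub>upper_triangular_ring m R\<^esub> C \<otimes>\<^bsub>upper_triangular_ring m R\<^esub> B"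
    by (auto simp: upper_triangular_ring_sel intro!: eq_matI)
qed

lemma upper_triangular_ring_abelian_group: "abelian_group (upper_triangular_ring m R)"
proof (rule abelian_groupI)
  fix A assume A: "A \<in> carrier (upper_triangular_ring m R)"
  show "\<exists>B\<in>carrier (upper_triangular_ring m R).
      B \<oplus>\<^bsub>upper_triangular_ring m R\<^esub> A = \<zero>\<^bsub>upper_triangular_ring m R\<^esub>"
    using A
    by (intro bexI[of _ "mat m m (\<lambda>(i, j). \<ominus> (A $$ (i, j)))"])
      (auto simp: upper_triangular_ring_sel l_neg intro!: eq_matI)
qed (auto simp: upper_triangular_ring_sel a_ac intro!: eq_matI)

lemma upper_triangular_ring_is_ring: "ring (upper_triangular_ring m R)"
proof (rule ringI)
  show "monoid (upper_triangular_ring m R)"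
    by (rule monoidI)
      (auto simp: upper_triangular_ring_mult_closed upper_triangular_ring_mult_assoc
        upper_triangular_ring_one, auto simp: upper_triangular_ring_sel)
qed (simp_all add: upper_triangular_ring_abelian_group upper_triangular_ring_distrib)

section \<open>Scalar matrices and diagonal entries\<close>

lemma scalar_matrix_hom:
  "ring_hom_ring R (upper_triangular_ring m R)
     (\<lambda>x. mat m m (\<lambda>(i, j). if i = j then x else \<zero>))"
proof (rule ring_hom_ringI[OF ring_axioms upper_triangular_ring_is_ring])
  fix x y assume xy: "x \<in> carrier R" "y \<in> carrier R"
  have "(\<Oplus>k\<in>{0..<m}. mat m m (\<lambda>(i, j). if i = j then x else \<zero>) $$ (i, k) \<otimes>
      mat m m (\<lambda>(i, j). if i = j then y else \<zero>) $$ (k, j)) = (if i = j then x \<otimes> y else \<zero>)"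
    if "i < m" "j < m" for i j
    using that xy by (subst finsum_single[of _ i]) auto
  then show "mat m m (\<lambda>(i, j). if i = j then x \<otimes> y else \<zero>) =
      mat m m (\<lambda>(i, j). if i = j then x else \<zero>) \<otimes>\<^bsub>upper_triangular_ring m R\<^esub>
      mat m m (\<lambda>(i, j). if i = j then y else \<zero>)"
    by (auto simp: upper_triangular_ring_sel intro!: eq_matI)
qed (auto simp: upper_triangular_ring_sel intro!: eq_matI)

text \<open>In \<open>\<Sum>\<^sub>k A\<^sub>i\<^sub>k B\<^sub>k\<^sub>i\<close> the left factor vanishes for \<open>k < i\<close> and the right factor for \<open>k > i\<close>.\<close>

lemma diagonal_entry_hom:
  assumes "i < m"
  shows "ring_hom_ring (upper_triangular_ring m R) R (\<lambda>A. A $$ (i, i))"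
proof (rule ring_hom_ringI[OF upper_triangular_ring_is_ring ring_axioms])
  fix A B
  assume AB: "A \<in> carrier (upper_triangular_ring m R)" "B \<in> carrier (upper_triangular_ring m R)"
  have "A $$ (i, k) \<otimes> B $$ (k, i) = \<zero>" if "k < m" "k \<noteq> i" for k
    using that assms AB by (cases "k < i") (auto simp: upper_triangular_ring_sel)
  then have "(\<Oplus>k\<in>{0..<m}. A $$ (i, k) \<otimes> B $$ (k, i)) = A $$ (i, i) \<otimes> B $$ (i, i)"
    using assms AB by (subst finsum_single[of _ i]) (auto simp: upper_triangular_ring_sel)
  then show "(A \<otimes>\<^bsub>upper_triangular_ring m R\<^esub> B) $$ (i, i) = A $$ (i, i) \<otimes> B $$ (i, i)"
    using assms by (simp add: upper_triangular_ring_sel)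
qed (use assms in \<open>auto simp: upper_triangular_ring_sel\<close>)

end

theorem theorem3p6:
  fixes S :: "('a, 'b) ring_scheme"
  assumes "ring S"
  shows "(\<forall>m n :: nat. m \<ge> 1 \<longrightarrow> n \<ge> 2 \<longrightarrow>
            (property_K (upper_triangular_ring m S) n \<longleftrightarrow> property_K S n)) \<and>
         (\<forall>m n :: nat. m \<ge> 1 \<longrightarrow> n \<ge> 2 \<longrightarrow>
            (property_Kbar (upper_triangular_ring m S) n \<longleftrightarrow> property_Kbar S n))"
proof -
  have "ring_hom_ring (upper_triangular_ring m S) S (\<lambda>A. A $$ (0, 0))" if "m \<ge> 1" for m
    using that by (intro ring.diagonal_entry_hom[OF assms]) simp
  moreover note ring.scalar_matrix_hom[OF assms]
  ultimately show ?thesis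
    by (meson ring_hom_ring.property_K_hom ring_hom_ring.property_Kbar_hom)
qed

end
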